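(* Let $(W,S)$ be a Coxeter system with $S$ finite, and let $\tilde{S}\subset S$ be the union of those irreducible components $S_i$ of $S$ for which $W_{S_i}$ is infinite. Then $Z(W)=Z(W_{S\setminus\tilde{S}})$ and $Z(W_{\tilde{S}})=1$.
   Context: A Coxeter group is a group $W$ having a presentation $\langle S \mid (st)^{m(s,t)}=1 \text{ for } s,t\in S\rangle$, where $S$ is a finite set and $m:S\times S\to \mathbb{N}\cup\{\infty\}$ satisfies: (1) $m(s,t)=m(t,s)$ for all $s,t\in S$; (2) $m(s,s)=1$ for all $s\in S$; (3) $m(s,t)\ge 2$ for all $s\ne t$ in $S$ (no relation is imposed when $m(s,t)=\infty$). The pair $(W,S)$ is called a Coxeter system. For $T\subset S$, $W_T$ denotes the (parabolic) subgroup of $W$ generated by $T$; $(W_T,T)$ is again a Coxeter system. A Coxeter system $(W,S)$ is irreducible if for every nonempty proper subset $T$ of $S$, $W$ is not the direct product of its subgroups $W_T$ and $W_{S\setminus T}$. There is a unique decomposition (partition) $\{S_1,\ldots,S_r\}$ of $S$ such that $W$ is the direct product of $W_{S_1},\ldots,W_{S_r}$ and each $(W_{S_i},S_i)$ is irreducible; the $S_i$ are the irreducible components. Define $\tilde{S}=\bigcup\{S_i \mid W_{S_i}\text{ is infinite}\}$; $W_{\tilde{S}}$ is called the essential parabolic subgroup of $(W,S)$. $Z(G)$ denotes the center of a group $G$. The equality $Z(W)=Z(W_{S\setminus\tilde S})$ is an equality of subgroups of $W$. *)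

theory Defs
  imports "HOL-Algebra.Algebra" "HOL-Library.Extended_Nat" "HOL-Library.Disjoint_Sets"
begin

section \<open>Group presentations\<close>

text \<open>A word over the alphabet of a set of generators and their formal inverses is a list of
  letters, where \<open>(s, True)\<close> stands for the letter s and \<open>(s, False)\<close> for its formal inverse.\<close>

type_synonym 'a word = "('a \<times> bool) list"

definition words :: "'a set \<Rightarrow> 'a word set" where
  "words S = lists (S \<times> UNIV)"

fun word_value :: "('a, 'b) monoid_scheme \<Rightarrow> 'a word \<Rightarrow> 'a" where
  "word_value G [] = \<one>\<^bsub>G\<^esub>"
| "word_value G ((s, b) # w) = (if b then s else inv\<^bsub>G\<^esub> s) \<otimes>\<^bsub>G\<^esub> word_value G w"

text \<open>Restricted to words over S, \<open>presented_eq S R\<close> identifies two words iff they represent the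
  same element of the group with generators S and relations r = 1 for r in R, i.e. of the
  quotient of the free group on S by the normal closure of R.  The rule \<open>cancel\<close> alone
  generates equality in the free group.\<close>

inductive presented_eq :: "'a set \<Rightarrow> 'a word set \<Rightarrow> 'a word \<Rightarrow> 'a word \<Rightarrow> bool"
  for S :: "'a set" and R :: "'a word set" where
  refl: "presented_eq S R u u"
| sym: "presented_eq S R u v \<Longrightarrow> presented_eq S R v u"
| trans: "presented_eq S R u v \<Longrightarrow> presented_eq S R v w \<Longrightarrow> presented_eq S R u w"
| cancel: "s \<in> S \<Longrightarrow> presented_eq S R (u @ [(s, b), (s, \<not> b)] @ v) (u @ v)"
| relator: "r \<in> R \<Longrightarrow> presented_eq S R (u @ r @ v) (u @ v)"

text \<open>The canonical homomorphism from the free group on S to G is onto, and its kernel is the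
  normal closure of R.\<close>

definition has_presentation :: "('a, 'b) monoid_scheme \<Rightarrow> 'a set \<Rightarrow> 'a word set \<Rightarrow> bool" where
  "has_presentation G S R \<longleftrightarrow>
     group G \<and> S \<subseteq> carrier G \<and> R \<subseteq> words S \<and> generate G S = carrier G \<and>
     (\<forall>w \<in> words S. word_value G w = \<one>\<^bsub>G\<^esub> \<longleftrightarrow> presented_eq S R w [])"


section \<open>Coxeter systems\<close>

definition coxeter_matrix :: "'a set \<Rightarrow> ('a \<Rightarrow> 'a \<Rightarrow> enat) \<Rightarrow> bool" where
  "coxeter_matrix S m \<longleftrightarrow>
     (\<forall>s\<in>S. \<forall>t\<in>S. m s t = m t s) \<and>
     (\<forall>s\<in>S. m s s = 1) \<and>
     (\<forall>s\<in>S. \<forall>t\<in>S. s \<noteq> t \<longrightarrow> m s t \<ge> 2)"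

text \<open>The words \<open>(s t)\<^sup>n\<close> with n = m(s,t) finite; there is no relator for m(s,t) infinite.\<close>

definition coxeter_relators :: "'a set \<Rightarrow> ('a \<Rightarrow> 'a \<Rightarrow> enat) \<Rightarrow> 'a word set" where
  "coxeter_relators S m =
     {concat (replicate n [(s, True), (t, True)]) | s t n. s \<in> S \<and> t \<in> S \<and> m s t = enat n}"

definition coxeter_system :: "('a, 'b) monoid_scheme \<Rightarrow> 'a set \<Rightarrow> bool" where
  "coxeter_system W S \<longleftrightarrow>
     finite S \<and> (\<exists>m. coxeter_matrix S m \<and> has_presentation W S (coxeter_relators S m))"

text \<open>The parabolic subgroup \<open>W\<^sub>T\<close> is \<open>subgroup_generated W T\<close> as a group and
  \<open>generate W T\<close> as a set.\<close>


section \<open>Irreducible components\<close>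

definition internal_direct_product ::
    "('a, 'b) monoid_scheme \<Rightarrow> 'i set \<Rightarrow> ('i \<Rightarrow> 'a set) \<Rightarrow> bool" where
  "internal_direct_product G I H \<longleftrightarrow>
     (\<forall>i\<in>I. H i \<lhd> G) \<and>
     generate G (\<Union>i\<in>I. H i) = carrier G \<and>
     (\<forall>i\<in>I. H i \<inter> generate G (\<Union>j\<in>I - {i}. H j) = {\<one>\<^bsub>G\<^esub>})"

definition coxeter_irreducible :: "('a, 'b) monoid_scheme \<Rightarrow> 'a set \<Rightarrow> bool" where
  "coxeter_irreducible W S \<longleftrightarrow>
     (\<forall>T. T \<noteq> {} \<and> T \<subset> S \<longrightarrow> \<not> internal_direct_product W {T, S - T} (generate W))"

definition irreducible_decomposition :: "('a, 'b) monoid_scheme \<Rightarrow> 'a set \<Rightarrow> 'a set set \<Rightarrow> bool" where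
  "irreducible_decomposition W S P \<longleftrightarrow>
     partition_on S P \<and>
     internal_direct_product W P (generate W) \<and>
     (\<forall>T\<in>P. coxeter_irreducible (subgroup_generated W T) T)"

text \<open>A Coxeter system has exactly one irreducible decomposition, so the description below is
  proper.\<close>

definition irreducible_components :: "('a, 'b) monoid_scheme \<Rightarrow> 'a set \<Rightarrow> 'a set set" where
  "irreducible_components W S = (THE P. irreducible_decomposition W S P)"

definition essential_generators :: "('a, 'b) monoid_scheme \<Rightarrow> 'a set \<Rightarrow> 'a set" where
  "essential_generators W S =
     \<Union>{T \<in> irreducible_components W S. infinite (carrier (subgroup_generated W T))}"

definition group_center :: "('a, 'b) monoid_scheme \<Rightarrow> 'a set" where
  "group_center G = {z \<in> carrier G. \<forall>x \<in> carrier G. z \<otimes>\<^bsub>G\<^esub> x = x \<otimes>\<^bsub>G\<^esub> z}"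

end

theory Submission
  imports Defs
begin

text \<open>
  Recording, for a word \<open>s\<^sub>1 \<dots> s\<^sub>k\<close>, which reflections occur an odd number of times among
  \<open>s\<^sub>k \<dots> s\<^sub>i\<^sub>+\<^sub>1 s\<^sub>i s\<^sub>i\<^sub>+\<^sub>1 \<dots> s\<^sub>k\<close> gives a cocycle on words.  It is trivial on the Coxeter relators,
  so it descends to the inversion set \<open>N(w)\<close> of an element, which is finite, determines \<open>w\<close>, and
  satisfies the exchange condition.

  If \<open>z\<close> is central, \<open>N(z)\<close> is invariant under conjugation.  For \<open>s \<in> N(z)\<close> and \<open>t \<notin> N(z)\<close> in
  \<open>S\<close> the element \<open>z s\<close> then has neither \<open>s\<close> nor \<open>t\<close> as a right descent, although \<open>t s t \<in> N(z s)\<close>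
  unless \<open>s\<close> and \<open>t\<close> commute; since an element without descents in \<open>{s, t}\<close> has no inversions in the
  parabolic subgroup of \<open>{s, t}\<close>, they do commute.  So \<open>N(z) \<inter> S\<close> is a union of irreducible
  components.  For a component \<open>T \<subseteq> N(z)\<close>, all inversions of elements of \<open>W\<^sub>T\<close> are conjugate to
  elements of \<open>T\<close>, hence lie in the finite set \<open>N(z)\<close>, and \<open>W\<^sub>T\<close> is finite.  Thus a central element
  has no descent in the essential generators; applied to the two factors of \<open>z\<close> in
  \<open>W = W\<^sub>S\<^sub>~ \<times> W\<^sub>S\<^sub>-\<^sub>S\<^sub>~\<close> this gives the theorem.
\<close>

section \<open>The inversion cocycle\<close>

locale coxeter = group W for W :: "('a, 'b) monoid_scheme" (structure) +
  fixes S :: "'a set" and m :: "'a \<Rightarrow> 'a \<Rightarrow> enat"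
  assumes matrix: "coxeter_matrix S m"
    and presentation: "has_presentation W S (coxeter_relators S m)"
begin

section \<open>Words in the generators and the subgroups they generate\<close>

lemma S_carrier: "S \<subseteq> carrier W"
  using presentation by (simp add: has_presentation_def)

lemma gen_closed [simp]: "s \<in> S \<Longrightarrow> s \<in> carrier W"
  using S_carrier by blast

lemma generate_S: "generate W S = carrier W"
  using presentation by (simp add: has_presentation_def)

lemma word_value_relator:
  assumes "r \<in> coxeter_relators S m"
  shows "word_value W r = \<one>"
proof -
  have "r \<in> words S" using presentation assms by (auto simp: has_presentation_def)
  moreover have "presented_eq S (coxeter_relators S m) r []"
    using presented_eq.relator[OF assms, of S "[]" "[]"] by simp
  ultimately show ?thesis using presentation by (simp add: has_presentation_def)
qed

lemma gen_square [simp]: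
  assumes "s \<in> S"
  shows "s \<otimes> s = \<one>"
proof -
  have "m s s = enat 1" using matrix assms by (simp add: coxeter_matrix_def one_enat_def)
  then have "concat (replicate 1 [(s, True), (s, True)]) \<in> coxeter_relators S m"
    using assms unfolding coxeter_relators_def by blast
  from word_value_relator[OF this] show ?thesis using assms by simp
qed

lemma gen_inv [simp]: "s \<in> S \<Longrightarrow> inv s = s"
  by (rule inv_equality) auto

text \<open>Words here carry no signs: generators are involutions, so dropping the signs of a word
  over \<open>S\<close> preserves its value.\<close>

definition val :: "'a list \<Rightarrow> 'a" where
  "val w = foldr (\<otimes>) w \<one>"

lemma val_Nil [simp]: "val [] = \<one>"
  by (simp add: val_def)

lemma val_Cons [simp]: "val (s # w) = s \<otimes> val w"
  by (simp add: val_def)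

lemma val_closed [simp]: "set w \<subseteq> S \<Longrightarrow> val w \<in> carrier W"
  by (induction w) auto

lemma val_append [simp]:
  "set u \<subseteq> S \<Longrightarrow> set v \<subseteq> S \<Longrightarrow> val (u @ v) = val u \<otimes> val v"
  by (induction u) (auto simp: m_assoc)

lemma val_rev: "set w \<subseteq> S \<Longrightarrow> val (rev w) = inv (val w)"
  by (induction w) (auto simp: inv_mult_group)

lemma word_value_eq_val: "w \<in> words S \<Longrightarrow> word_value W w = val (map fst w)"
  by (induction w) (auto simp: words_def)

lemma generate_eq_val:
  assumes "J \<subseteq> S"
  shows "generate W J = {val w |w. set w \<subseteq> J}"
proof
  have J: "set w \<subseteq> S" if "set w \<subseteq> J" for w using that assms by auto
  show "generate W J \<subseteq> {val w |w. set w \<subseteq> J}"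
  proof
    fix x assume "x \<in> generate W J"
    then show "x \<in> {val w |w. set w \<subseteq> J}"
    proof induction
      case one show ?case by (intro CollectI exI[of _ "[]"]) auto
    next
      case (incl h) then show ?case using assms by (intro CollectI exI[of _ "[h]"]) auto
    next
      case (inv h) then show ?case using assms by (intro CollectI exI[of _ "[h]"]) auto
    next
      case (eng g h)
      then obtain u v where "set u \<subseteq> J" "set v \<subseteq> J" "g = val u" "h = val v" by blast
      then show ?case using J by (intro CollectI exI[of _ "u @ v"]) auto
    qed
  qed
  have "val w \<in> generate W J" if "set w \<subseteq> J" for w
    using that by (induction w) (auto intro: generate.intros)
  then show "{val w |w. set w \<subseteq> J} \<subseteq> generate W J" by blast
qed

lemma generate_valE:
  assumes "x \<in> generate W J" "J \<subseteq> S"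
  obtains w where "set w \<subseteq> J" "x = val w"
  using assms(1) unfolding generate_eq_val[OF assms(2)] by blast

lemma carrier_valE:
  assumes "x \<in> carrier W"
  obtains w where "set w \<subseteq> S" "x = val w"
  using assms generate_valE[of x S] generate_S by blast

lemma generate_closed: "J \<subseteq> S \<Longrightarrow> x \<in> generate W J \<Longrightarrow> x \<in> carrier W"
  using generate_incl[of J] S_carrier by blast

section \<open>Parity of reflections along a word\<close>

text \<open>The \<open>i\<close>-th reflection of \<open>s\<^sub>1 \<dots> s\<^sub>k\<close> is \<open>v\<inverse> s\<^sub>i v\<close> for the suffix \<open>v = s\<^sub>i\<^sub>+\<^sub>1 \<dots> s\<^sub>k\<close>;
  \<open>odd_at w r\<close> says that \<open>r\<close> occurs an odd number of times among the reflections of \<open>w\<close>.\<close>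

primrec odd_at :: "'a list \<Rightarrow> 'a \<Rightarrow> bool" where
  "odd_at [] r = False"
| "odd_at (s # w) r = (odd_at w r \<noteq> (val w \<otimes> r = s \<otimes> val w))"

definition conj_by :: "'a \<Rightarrow> 'a \<Rightarrow> 'a" where
  "conj_by x r = x \<otimes> r \<otimes> inv x"

lemma conj_by_closed [simp]: "x \<in> carrier W \<Longrightarrow> r \<in> carrier W \<Longrightarrow> conj_by x r \<in> carrier W"
  by (simp add: conj_by_def)

lemma conj_by_one [simp]: "r \<in> carrier W \<Longrightarrow> conj_by \<one> r = r"
  by (simp add: conj_by_def)

lemma conj_by_mult:
  "x \<in> carrier W \<Longrightarrow> y \<in> carrier W \<Longrightarrow> r \<in> carrier W \<Longrightarrow>
    conj_by (x \<otimes> y) r = conj_by x (conj_by y r)"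
  by (simp add: conj_by_def inv_mult_group m_assoc)

lemma conj_by_eq_iff:
  "x \<in> carrier W \<Longrightarrow> r \<in> carrier W \<Longrightarrow> s \<in> carrier W \<Longrightarrow>
    conj_by x r = s \<longleftrightarrow> x \<otimes> r = s \<otimes> x"
  by (metis conj_by_def inv_solve_right m_closed)

text \<open>The cocycle identity: the reflections of \<open>u @ v\<close> are those of
  \<open>v\<close> together with those of \<open>u\<close> conjugated by the inverse of
  \<open>val v\<close>.\<close>

lemma odd_at_append:
  assumes "set u \<subseteq> S" "set v \<subseteq> S" "r \<in> carrier W"
  shows "odd_at (u @ v) r = (odd_at v r \<noteq> odd_at u (conj_by (val v) r))"
  using assms(1)
proof (induction u)
  case (Cons s u)
  have "val (u @ v) \<otimes> r = s \<otimes> val (u @ v) \<longleftrightarrow> conj_by (val (u @ v)) r = s"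
    using Cons assms by (simp add: conj_by_eq_iff)
  also have "\<dots> \<longleftrightarrow> conj_by (val u) (conj_by (val v) r) = s"
    using Cons assms by (simp add: conj_by_mult)
  also have "\<dots> \<longleftrightarrow> val u \<otimes> conj_by (val v) r = s \<otimes> val u"
    using Cons assms by (simp add: conj_by_eq_iff)
  finally show ?case using Cons by auto
qed simp

lemma val_alternating:
  assumes "s \<in> S" "t \<in> S"
  shows "val (concat (replicate n [s, t])) = (s \<otimes> t) [^] n"
proof (induction n)
  case (Suc n)
  then have "val (concat (replicate (Suc n) [s, t])) = s \<otimes> t \<otimes> (s \<otimes> t) [^] n"
    using assms by (simp add: m_assoc)
  then show ?case using assms nat_pow_Suc2[of "s \<otimes> t" n] by simp
qed simp

lemma swap_pow:
  assumes "s \<in> S" "t \<in> S"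
  shows "t \<otimes> (s \<otimes> t) [^] (n::nat) = (t \<otimes> s) [^] n \<otimes> t"
proof (induction n)
  case (Suc n)
  have "t \<otimes> (s \<otimes> t) [^] Suc n = t \<otimes> (s \<otimes> t) [^] n \<otimes> (s \<otimes> t)"
    using assms by (simp add: m_assoc)
  then show ?case using assms unfolding Suc by (simp add: m_assoc)
qed (use assms in simp)

lemma inv_gen_mult_pow:
  assumes "s \<in> S" "t \<in> S"
  shows "inv ((s \<otimes> t) [^] (n::nat)) = (t \<otimes> s) [^] n"
  using assms nat_pow_inv[of "s \<otimes> t" n] by (simp add: inv_mult_group)

text \<open>Read from the right, the reflections of the alternating word are t, tst, tstst and so
  on, so the one with index i is (ts)^i t.\<close>

lemma odd_at_alternating:
  assumes "s \<in> S" "t \<in> S" "r \<in> carrier W"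
  shows "odd_at (concat (replicate n [s, t])) r
    = odd (\<Sum>i<2 * n. of_bool (r = (t \<otimes> s) [^] i \<otimes> t) :: nat)"
proof (induction n)
  case (Suc n)
  let ?c = "(s \<otimes> t) [^] n" and ?d = "t \<otimes> s"
  have solve: "?c \<otimes> r = x \<otimes> ?c \<longleftrightarrow> r = ?d [^] n \<otimes> (x \<otimes> ?c)" if "x \<in> carrier W" for x
    using inv_solve_left[of r ?c "x \<otimes> ?c"] that assms by (auto simp: inv_gen_mult_pow)
  \<comment> \<open>Prepending \<open>[s, t]\<close> adds two reflections: the letter
    \<open>t\<close> gives index 2n, then the letter \<open>s\<close> gives index 2n + 1.\<close>
  have "?c \<otimes> r = t \<otimes> ?c \<longleftrightarrow> r = ?d [^] (2 * n) \<otimes> t"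
  proof -
    have "?d [^] n \<otimes> (t \<otimes> ?c) = ?d [^] (2 * n) \<otimes> t"
      unfolding swap_pow[OF assms(1,2)] using assms
      by (simp add: m_assoc[symmetric] nat_pow_mult mult_2)
    then show ?thesis using assms by (simp add: solve)
  qed
  moreover have "t \<otimes> ?c \<otimes> r = s \<otimes> (t \<otimes> ?c) \<longleftrightarrow> r = ?d [^] (2 * n + 1) \<otimes> t"
  proof -
    \<comment> \<open>Since tt = 1, a factor \<open>t\<close> can be pulled out on the left of both
      sides and cancelled, which leaves an instance of \<open>solve\<close> with x = tst.\<close>
    have "t \<otimes> ((t \<otimes> s \<otimes> t) \<otimes> ?c) = (t \<otimes> t) \<otimes> (s \<otimes> (t \<otimes> ?c))"
      using assms by (simp add: m_assoc del: gen_square)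
    then have "s \<otimes> (t \<otimes> ?c) = t \<otimes> ((t \<otimes> s \<otimes> t) \<otimes> ?c)" using assms by simp
    then have "t \<otimes> ?c \<otimes> r = s \<otimes> (t \<otimes> ?c) \<longleftrightarrow> ?c \<otimes> r = (t \<otimes> s \<otimes> t) \<otimes> ?c"
      using assms m_assoc[of t ?c r] by (simp del: gen_square)
    also have "\<dots> \<longleftrightarrow> r = ?d [^] n \<otimes> ((t \<otimes> s \<otimes> t) \<otimes> ?c)"
      using assms by (intro solve) auto
    also have "?d [^] n \<otimes> ((t \<otimes> s \<otimes> t) \<otimes> ?c) = ?d [^] Suc n \<otimes> (t \<otimes> ?c)"
      using assms by (simp add: m_assoc)
    also have "\<dots> = ?d [^] Suc n \<otimes> ?d [^] n \<otimes> t"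
      unfolding swap_pow[OF assms(1,2)] using assms by (simp add: m_assoc del: nat_pow_Suc)
    also have "?d [^] Suc n \<otimes> ?d [^] n = ?d [^] (2 * n + 1)"
      using assms by (subst nat_pow_mult) (simp_all add: mult_2 del: nat_pow_Suc)
    finally show ?thesis .
  qed
  ultimately show ?case using Suc assms by (auto simp: val_alternating)
qed simp

text \<open>If \<open>(t s)\<^sup>n = 1\<close>, the \<open>2n\<close> reflections of \<open>(s t)\<^sup>n\<close> are \<open>n\<close>-periodic and cancel in pairs.\<close>

lemma odd_at_relator:
  assumes "w \<in> coxeter_relators S m" "r \<in> carrier W"
  shows "\<not> odd_at (map fst w) r"
proof -
  obtain s t n where st: "s \<in> S" "t \<in> S" and w: "w = concat (replicate n [(s, True), (t, True)])"
    using assms(1) by (auto simp: coxeter_relators_def)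
  have map_w: "map fst w = concat (replicate n [s, t])"
    unfolding w by (induction n) auto
  have "w \<in> words S" using assms(1) presentation by (auto simp: has_presentation_def)
  then have "(s \<otimes> t) [^] n = \<one>"
    using word_value_relator[OF assms(1)] word_value_eq_val[of w] map_w val_alternating[OF st] by simp
  then have "(t \<otimes> s) [^] n = \<one>"
    using inv_gen_mult_pow[OF st, of n] by simp
  then have per: "(t \<otimes> s) [^] (n + i) = (t \<otimes> s) [^] i" for i
    using st by (simp add: nat_pow_mult[symmetric])
  define f where "f i = (of_bool (r = (t \<otimes> s) [^] i \<otimes> t) :: nat)" for i :: nat
  have "(\<Sum>i<n + k. f i) = (\<Sum>i<n. f i) + (\<Sum>i<k. f i)" for k
    by (induction k) (auto simp: f_def per)
  from this[of n] have "even (\<Sum>i<2 * n. f i)" by (simp add: mult_2)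
  then show ?thesis unfolding map_w odd_at_alternating[OF st assms(2)] f_def by simp
qed

text \<open>\<open>presented_eq\<close> also relates words with letters outside \<open>S\<close>.
  Carrying membership in \<open>S\<close> along as part of the invariant is what lets the induction
  pass through transitivity.\<close>

lemma presented_eq_odd_at:
  assumes "presented_eq S (coxeter_relators S m) u v" "r \<in> carrier W"
  shows "(set (map fst u) \<subseteq> S \<longleftrightarrow> set (map fst v) \<subseteq> S) \<and>
    (set (map fst u) \<subseteq> S \<longrightarrow> odd_at (map fst u) r = odd_at (map fst v) r)"
  using assms(1)
proof induction
  case (cancel s u b v)
  have "odd_at (map fst u @ [s, s] @ map fst v) r = odd_at (map fst u @ map fst v) r"
    if uv: "set (map fst u) \<subseteq> S" "set (map fst v) \<subseteq> S"
  proof -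
    let ?v = "val (map fst v)"
    have ss: "set [s, s] \<subseteq> S" "set ([s, s] @ map fst v) \<subseteq> S" using cancel uv by auto
    have "val [s, s] = \<one>" "val ([s, s] @ map fst v) = ?v"
      using cancel uv val_append[OF ss(1) uv(2)] by auto
    \<comment> \<open>Both reflections of the word ss equal \<open>s\<close>, so they
      cancel.\<close>
    moreover have "\<not> odd_at [s, s] x" if "x \<in> carrier W" for x
      using cancel that l_cancel[of s x s] by auto
    ultimately show ?thesis
      using odd_at_append[OF uv(1) ss(2) assms(2)] odd_at_append[OF uv assms(2)]
        odd_at_append[OF ss(1) uv(2) assms(2)] uv assms(2)
      by simp
  qed
  then show ?case using cancel by auto
next
  case (relator w u v)
  have "w \<in> words S" using relator presentation by (auto simp: has_presentation_def)
  then have w: "set (map fst w) \<subseteq> S" by (auto simp: words_def)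
  have "val (map fst w) = \<one>"
    using word_value_relator[OF relator] word_value_eq_val[OF \<open>w \<in> words S\<close>] by simp
  moreover have "\<not> odd_at (map fst w) x" if "x \<in> carrier W" for x
    using odd_at_relator[OF relator that] .
  ultimately show ?case using w assms(2) by (auto simp: odd_at_append)
qed auto

text \<open>Here the presentation enters in full: a word of value 1 reduces to the empty word by
  cancellations and relators alone, and these preserve the parity.\<close>

lemma odd_at_val_one:
  assumes "set w \<subseteq> S" "val w = \<one>" "r \<in> carrier W"
  shows "\<not> odd_at w r"
proof -
  let ?w = "map (\<lambda>s. (s, True)) w"
  have w: "?w \<in> words S" and fst: "map fst ?w = w"
    using assms(1) by (auto simp: words_def comp_def)
  have "word_value W ?w = \<one>" using word_value_eq_val[OF w] assms(2) fst by simp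
  then have "presented_eq S (coxeter_relators S m) ?w []"
    using presentation w by (simp add: has_presentation_def)
  from presented_eq_odd_at[OF this assms(3)] show ?thesis
    unfolding fst using assms(1) by auto
qed

text \<open>Appending \<open>rev v\<close> to \<open>u\<close> and to \<open>v\<close> gives two
  words of value 1, hence of trivial parity. The common contribution of \<open>rev v\<close> drops
  out of the cocycle identity.\<close>

lemma odd_at_val_eq:
  assumes "set u \<subseteq> S" "set v \<subseteq> S" "val u = val v" "r \<in> carrier W"
  shows "odd_at u r = odd_at v r"
proof -
  have rv: "set (rev v) \<subseteq> S" using assms by auto
  have "val (u @ rev v) = \<one>" "val (v @ rev v) = \<one>" using assms rv val_rev by auto
  then have "\<not> odd_at (u @ rev v) x" "\<not> odd_at (v @ rev v) x" if "x \<in> carrier W" for x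
    using odd_at_val_one[of "u @ rev v"] odd_at_val_one[of "v @ rev v"] assms rv that by auto
  then have eq: "odd_at u (conj_by (val (rev v)) x) = odd_at v (conj_by (val (rev v)) x)"
    if "x \<in> carrier W" for x
    using that odd_at_append[OF assms(1) rv that] odd_at_append[OF assms(2) rv that] by simp
  have "conj_by (val (rev v)) (conj_by (val v) r) = r"
    using assms rv by (simp add: val_rev conj_by_mult[symmetric])
  with eq[of "conj_by (val v) r"] show ?thesis using assms by simp
qed

section \<open>Inversion sets, deletion and descents\<close>

text \<open>For reflections \<open>r\<close>, \<open>r \<in> inversions g\<close> means \<open>\<ell>(g r) < \<ell>(g)\<close>.\<close>

definition inversions :: "'a \<Rightarrow> 'a set" where
  "inversions g = {r \<in> carrier W. \<exists>w. set w \<subseteq> S \<and> val w = g \<and> odd_at w r}"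

lemma inversions_val: "set w \<subseteq> S \<Longrightarrow> inversions (val w) = {r \<in> carrier W. odd_at w r}"
  using odd_at_val_eq by (auto simp: inversions_def)

lemma inversions_one [simp]: "inversions \<one> = {}"
  using inversions_val[of "[]"] by simp

lemma inversions_gen:
  assumes "s \<in> S"
  shows "inversions s = {s}"
proof -
  have "inversions (val [s]) = {r \<in> carrier W. odd_at [s] r}"
    using assms by (intro inversions_val) simp
  moreover have "val [s] = s" using assms by simp
  moreover have "{r \<in> carrier W. odd_at [s] r} = {s}"
  proof (rule Set.set_eqI)
    fix r
    have "odd_at [s] r \<longleftrightarrow> r = s" if "r \<in> carrier W" using assms that by simp
    then show "r \<in> {r \<in> carrier W. odd_at [s] r} \<longleftrightarrow> r \<in> {s}"
      using gen_closed[OF assms] by blast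
  qed
  ultimately show ?thesis by simp
qed

text \<open>Generators do not collapse in the presented group: the inversion set tells
  \<open>s\<close> from 1.\<close>

lemma gen_not_one: "s \<in> S \<Longrightarrow> s \<noteq> \<one>"
  using inversions_gen inversions_one by force

text \<open>The cocycle identity for group elements: N(gh) is the symmetric difference of N(h) and
  the conjugate of N(g) by the inverse of h.\<close>

lemma mem_inversions_mult:
  assumes "g \<in> carrier W" "h \<in> carrier W" "r \<in> carrier W"
  shows "r \<in> inversions (g \<otimes> h) \<longleftrightarrow> (r \<in> inversions h) \<noteq> (conj_by h r \<in> inversions g)"
proof -
  obtain u v where uv: "set u \<subseteq> S" "set v \<subseteq> S" "g = val u" "h = val v"
    using carrier_valE[OF assms(1)] carrier_valE[OF assms(2)] by metis
  have "r \<in> inversions (val u \<otimes> val v) \<longleftrightarrow> odd_at (u @ v) r"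
    using inversions_val[of "u @ v"] uv(1,2) assms(3) by auto
  then show ?thesis
    using odd_at_append[OF uv(1,2) assms(3)] inversions_val[OF uv(1)] inversions_val[OF uv(2)]
      conj_by_closed[OF assms(2,3)] assms(3)
    unfolding uv(3,4) by blast
qed

text \<open>The exchange condition. An odd count is nonzero, so \<open>r\<close> is the reflection
  of some letter of \<open>w\<close>, and multiplying by \<open>r\<close> deletes that letter.
  Deletion keeps the word inside \<open>J\<close>.\<close>

lemma odd_at_deletion:
  assumes "J \<subseteq> S" "set w \<subseteq> J" "r \<in> carrier W" "odd_at w r"
  shows "\<exists>w'. set w' \<subseteq> J \<and> length w' < length w \<and> val w' = val w \<otimes> r"
  using assms(2,4)
proof (induction w)
  case (Cons s w)
  have J: "s \<in> J" "set w \<subseteq> J" using Cons.prems(1) by auto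
  then have w: "s \<in> S" "set w \<subseteq> S" using assms(1) by auto
  show ?case
  proof (cases "odd_at w r")
    case True
    then obtain w' where "set w' \<subseteq> J" "length w' < length w" "val w' = val w \<otimes> r"
      using Cons.IH J by blast
    then have "set (s # w') \<subseteq> J \<and> length (s # w') < length (s # w) \<and> val (s # w') = val (s # w) \<otimes> r"
      using J w assms(3) by (simp add: m_assoc)
    then show ?thesis by blast
  next
    case False
    then have swap: "val w \<otimes> r = s \<otimes> val w" using Cons.prems(2) by simp
    have "val (s # w) \<otimes> r = s \<otimes> (val w \<otimes> r)" using w assms(3) by (simp add: m_assoc)
    also have "\<dots> = (s \<otimes> s) \<otimes> val w" unfolding swap using w by (simp add: m_assoc del: gen_square)
    also have "\<dots> = val w" using w by simp
    finally have "val w = val (s # w) \<otimes> r" by (rule HOL.sym)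
    moreover have "length w < length (s # w)" by simp
    ultimately show ?thesis using J by blast
  qed
qed simp

text \<open>The last letter of a shortest \<open>J\<close>-word for \<open>u\<close> is a
  descent.\<close>

lemma ex_descent:
  assumes "J \<subseteq> S" "u \<in> generate W J" "u \<noteq> \<one>"
  shows "\<exists>j\<in>J. j \<in> inversions u"
proof -
  let ?P = "\<lambda>w. set w \<subseteq> J \<and> val w = u"
  have "\<exists>w. ?P w" using generate_valE[OF assms(2,1)] by metis
  then obtain w where w: "?P w" and min: "\<And>v. ?P v \<Longrightarrow> length w \<le> length v"
    using ex_has_least_nat[of ?P _ length] by blast
  from w assms(3) have "w \<noteq> []" by auto
  then obtain v j where wv: "w = v @ [j]" by (metis rev_exhaust)
  have vj: "set v \<subseteq> J" "j \<in> J" "set v \<subseteq> S" "j \<in> S" using w wv assms by auto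
  have "\<not> odd_at v j"
  \<comment> \<open>Otherwise deletion turns \<open>v @ [j]\<close> into a word for \<open>u\<close>
    shorter than \<open>v\<close>.\<close>
  proof
    assume "odd_at v j"
    then obtain v' where v': "set v' \<subseteq> J" "length v' < length v" "val v' = val v \<otimes> j"
      using odd_at_deletion[OF assms(1) vj(1) gen_closed[OF vj(4)]] by blast
    moreover from this(3) have "val v' = u" using w wv vj by auto
    ultimately have "?P v'" by blast
    from min[OF this] show False using v' wv by simp
  qed
  moreover have "conj_by j j = j" using vj by (simp add: conj_by_def)
  ultimately have "odd_at w j" using vj unfolding wv by (simp add: odd_at_append)
  moreover have "set w \<subseteq> S" using vj wv by simp
  ultimately have "j \<in> inversions (val w)" using inversions_val[of w] vj(4) by simp
  then show ?thesis using w vj(2) by blast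
qed

lemma no_descent_imp_one:
  assumes "g \<in> carrier W" "inversions g \<inter> S = {}"
  shows "g = \<one>"
  using ex_descent[OF subset_refl, of g] assms unfolding generate_S by blast

text \<open>\<open>v\<close> is the value of the suffix after a letter \<open>j\<close> of a
  \<open>J\<close>-word whose reflection is \<open>r\<close>.\<close>

lemma mem_inversions_generate:
  assumes "J \<subseteq> S" "u \<in> generate W J" "r \<in> inversions u"
  shows "\<exists>v \<in> generate W J. \<exists>j\<in>J. r \<in> carrier W \<and> conj_by v r = j"
proof -
  obtain w where w: "set w \<subseteq> J" "u = val w" using generate_valE[OF assms(2,1)] .
  then have "set w \<subseteq> S" using assms(1) by blast
  then have r: "r \<in> carrier W" "odd_at w r" using assms(3) w(2) inversions_val[of w] by auto
  have "\<exists>v. set v \<subseteq> J \<and> (\<exists>j\<in>J. conj_by (val v) r = j)"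
    using w(1) r(2)
  proof (induction w)
    case (Cons s w)
    then have "set w \<subseteq> S" "s \<in> S" using assms(1) by auto
    then have "odd_at w r \<or> conj_by (val w) r = s"
      using Cons.prems(2) conj_by_eq_iff[of "val w" r s] r(1) by auto
    moreover have "set w \<subseteq> J" "s \<in> J" using Cons.prems(1) by auto
    ultimately show ?case using Cons.IH by blast
  qed simp
  then obtain v j where "set v \<subseteq> J" "j \<in> J" "conj_by (val v) r = j" by blast
  moreover from this(1) have "val v \<in> generate W J" unfolding generate_eq_val[OF assms(1)] by blast
  ultimately show ?thesis using r(1) by blast
qed

lemma generate_conj_closed:
  assumes "J \<subseteq> S" "v \<in> generate W J" "r \<in> carrier W"
  shows "conj_by v r \<in> generate W J \<longleftrightarrow> r \<in> generate W J"
proof -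
  have sub: "subgroup (generate W J) W"
    using assms S_carrier by (intro generate_is_subgroup) blast
  have cl: "conj_by x y \<in> generate W J" if "x \<in> generate W J" "y \<in> generate W J" for x y
    using that sub by (simp add: conj_by_def subgroup.m_closed subgroup.m_inv_closed)
  have v: "v \<in> carrier W" "inv v \<in> generate W J"
    using generate_closed[OF assms(1,2)] subgroup.m_inv_closed[OF sub assms(2)] by auto
  have "conj_by (inv v) (conj_by v r) = r"
    using v assms by (simp add: conj_by_mult[symmetric])
  then show ?thesis using cl[OF assms(2), of r] cl[OF v(2), of "conj_by v r"] by auto
qed

lemma inversions_generate:
  assumes "J \<subseteq> S" "u \<in> generate W J"
  shows "inversions u \<subseteq> generate W J"
proof
  fix r assume "r \<in> inversions u"
  from mem_inversions_generate[OF assms this]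
  obtain v j where "v \<in> generate W J" "j \<in> J" "r \<in> carrier W" "conj_by v r = j" by blast
  then show "r \<in> generate W J"
    using generate_conj_closed[OF assms(1), of v r] generate.incl[of j J W] by simp
qed

section \<open>Parabolic subgroups and central elements\<close>

text \<open>A nontrivial common element has a descent in \<open>I\<close>, which lies in the
  subgroup of \<open>J\<close> because all inversions do. A generator is its own only inversion, so
  it belongs to \<open>J\<close> as well.\<close>

lemma generate_disjoint:
  assumes "I \<subseteq> S" "J \<subseteq> S" "I \<inter> J = {}"
  shows "generate W I \<inter> generate W J = {\<one>}"
proof -
  have "x = \<one>" if x: "x \<in> generate W I" "x \<in> generate W J" for x
  proof (rule ccontr)
    assume "x \<noteq> \<one>"
    then obtain i where i: "i \<in> I" "i \<in> inversions x" using ex_descent[OF assms(1) x(1)] by blast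
    then have "i \<in> generate W J" using inversions_generate[OF assms(2) x(2)] by blast
    moreover have iS: "i \<in> S" using i assms(1) by blast
    ultimately obtain j where "j \<in> J" "j \<in> inversions i"
      using ex_descent[OF assms(2) _ gen_not_one[OF iS]] by blast
    then have "i \<in> J" using inversions_gen[OF iS] by simp
    then show False using i(1) assms(3) by blast
  qed
  then show ?thesis using generate.one[of W I] generate.one[of W J] by blast
qed

text \<open>An element without right descents in \<open>J\<close> is the shortest element of its coset \<open>y W\<^sub>J\<close>.\<close>

lemma inversions_disjoint_parabolic:
  assumes J: "J \<subseteq> S" and y: "y \<in> carrier W" and no: "inversions y \<inter> J = {}"
  shows "inversions y \<inter> generate W J = {}"
proof -
  have sub: "subgroup (generate W J) W"
    using J S_carrier by (intro generate_is_subgroup) blast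
  \<comment> \<open>Words for elements of the coset of \<open>y\<close>; a shortest one is taken,
    and its value is then shown to be \<open>y\<close>.\<close>
  let ?P = "\<lambda>w. set w \<subseteq> S \<and> (\<exists>v \<in> generate W J. val w = y \<otimes> v)"
  obtain w0 where "set w0 \<subseteq> S" "y = val w0" using carrier_valE[OF y] .
  then have "?P w0" using y generate.one[of W J] by (auto intro!: bexI[of _ \<one>])
  then obtain w where w: "?P w" and min: "\<And>w'. ?P w' \<Longrightarrow> length w \<le> length w'"
    using ex_has_least_nat[of ?P _ length] by blast
  then obtain v where v: "v \<in> generate W J" "val w = y \<otimes> v" by blast
  have vc: "v \<in> carrier W" using generate_closed[OF J v(1)] .
  \<comment> \<open>An inversion in the parabolic subgroup would shorten \<open>w\<close> without
    leaving the coset.\<close>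
  have disj: "inversions (val w) \<inter> generate W J = {}"
  proof (rule ccontr)
    assume "\<not> ?thesis"
    then obtain r where r: "r \<in> generate W J" "r \<in> carrier W" "odd_at w r"
      using w inversions_val[of w] by auto
    then obtain w' where w': "set w' \<subseteq> S" "length w' < length w" "val w' = val w \<otimes> r"
      using odd_at_deletion[OF subset_refl _ r(2,3)] w by blast
    then have "val w' = y \<otimes> (v \<otimes> r)" using v(2) vc r(2) y by (simp add: m_assoc)
    moreover have "v \<otimes> r \<in> generate W J" using v(1) r(1) by (rule generate.eng)
    ultimately have "?P w'" using w'(1) by blast
    from min[OF this] show False using w' by simp
  qed
  have iv: "inv v \<in> generate W J" "inv v \<in> carrier W"
    using v vc sub by (auto simp: subgroup.m_inv_closed)
  have y_eq: "y = val w \<otimes> inv v" using v vc y by (simp add: m_assoc)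
  \<comment> \<open>A descent \<open>j\<close> of \<open>inv v\<close> stays a descent of
    \<open>y\<close>: its conjugate lies in the parabolic subgroup, where \<open>val w\<close> has
    no inversions to cancel it.\<close>
  have "inv v = \<one>"
  proof (rule ccontr)
    assume "inv v \<noteq> \<one>"
    then obtain j where j: "j \<in> J" "j \<in> inversions (inv v)" using ex_descent[OF J iv(1)] by blast
    then have "j \<in> generate W J" "j \<in> carrier W" using generate.incl[of j J W] J by auto
    then have "conj_by (inv v) j \<notin> inversions (val w)"
      using generate_conj_closed[OF J iv(1), of j] disj by blast
    then have "j \<in> inversions y"
      using mem_inversions_mult[of "val w" "inv v" j] w iv j \<open>j \<in> carrier W\<close>
      unfolding y_eq by simp
    then show False using no j by blast
  qed
  then have "y = val w" using y_eq w by simp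
  then show ?thesis using disj by simp
qed

text \<open>Expand N(zx) = N(xz) by the cocycle identity on both sides; since \<open>z\<close> fixes
  \<open>r\<close> under conjugation, the contributions of N(x) agree and cancel.\<close>

lemma inversions_central_conj:
  assumes "z \<in> group_center W" "x \<in> carrier W" "r \<in> carrier W"
  shows "conj_by x r \<in> inversions z \<longleftrightarrow> r \<in> inversions z"
proof -
  have z: "z \<in> carrier W" "z \<otimes> x = x \<otimes> z" "z \<otimes> r = r \<otimes> z"
    using assms by (auto simp: group_center_def)
  then have "conj_by z r = r" using assms by (simp add: conj_by_eq_iff)
  then show ?thesis
    using mem_inversions_mult[of z x r] mem_inversions_mult[of x z r] z assms by auto
qed

lemma central_descents_commute:
  assumes z: "z \<in> group_center W"
    and s: "s \<in> S" "s \<in> inversions z" and t: "t \<in> S" "t \<notin> inversions z"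
  shows "s \<otimes> t = t \<otimes> s"
proof (rule ccontr)
  assume ne: "s \<otimes> t \<noteq> t \<otimes> s"
  let ?r = "conj_by t s"
  have zc: "z \<in> carrier W" using z by (simp add: group_center_def)
  \<comment> \<open>By conjugation invariance, N(zs) is the symmetric difference of N(z) and {s},
    and \<open>s\<close> lies in N(z).\<close>
  have N: "x \<in> inversions (z \<otimes> s) \<longleftrightarrow> x \<noteq> s \<and> x \<in> inversions z" if "x \<in> carrier W" for x
    using mem_inversions_mult[OF zc _ that] inversions_central_conj[OF z _ that] inversions_gen s
    by auto
  have "inversions (z \<otimes> s) \<inter> {s, t} = {}" using N s t by auto
  then have "inversions (z \<otimes> s) \<inter> generate W {s, t} = {}"
    using s t zc by (intro inversions_disjoint_parabolic) auto
  moreover have "?r \<in> inversions (z \<otimes> s)"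
    using N[of ?r] inversions_central_conj[OF z, of t s] conj_by_eq_iff[of t s s] s t ne by auto
  moreover have "?r \<in> generate W {s, t}"
    using s t by (simp add: conj_by_def generate.intros)
  ultimately show False by blast
qed

text \<open>Each letter of a word contributes at most one reflection.\<close>

lemma finite_inversions:
  assumes "g \<in> carrier W"
  shows "finite (inversions g)"
proof -
  obtain w where w: "set w \<subseteq> S" "g = val w" using carrier_valE[OF assms] .
  have "finite {r \<in> carrier W. odd_at w r}"
    using w(1)
  proof (induction w)
    case (Cons s w)
    have "{r \<in> carrier W. odd_at (s # w) r}
        \<subseteq> {r \<in> carrier W. odd_at w r} \<union> {inv (val w) \<otimes> (s \<otimes> val w)}"
    proof
      fix r assume r: "r \<in> {r \<in> carrier W. odd_at (s # w) r}"
      have c: "val w \<in> carrier W" "s \<otimes> val w \<in> carrier W" using Cons.prems by auto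
      then show "r \<in> {r \<in> carrier W. odd_at w r} \<union> {inv (val w) \<otimes> (s \<otimes> val w)}"
        using r inv_solve_left[of r "val w" "s \<otimes> val w"] by auto
    qed
    moreover have "finite {r \<in> carrier W. odd_at w r}" using Cons by simp
    ultimately show ?case by (meson finite.intros finite_UnI finite_subset)
  qed simp
  then show ?thesis using w inversions_val[of w] by simp
qed

text \<open>If N(x) = N(y), the cocycle identity gives the product of \<open>x\<close> and
  \<open>inv y\<close> the inversions of 1, hence no descents.\<close>

lemma inversions_inj: "inj_on inversions (carrier W)"
proof (rule inj_onI)
  fix x y assume xy: "x \<in> carrier W" "y \<in> carrier W" "inversions x = inversions y"
  have "r \<in> inversions (x \<otimes> inv y) \<longleftrightarrow> r \<in> inversions (y \<otimes> inv y)" if "r \<in> carrier W" for r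
    using mem_inversions_mult[OF xy(1) inv_closed[OF xy(2)] that]
      mem_inversions_mult[OF xy(2) inv_closed[OF xy(2)] that] xy(3) by simp
  then have "inversions (x \<otimes> inv y) \<inter> S = {}" using xy by auto
  then have "x \<otimes> inv y = \<one>" using no_descent_imp_one xy by blast
  then show "x = y" using inv_equality[of x "inv y"] xy by simp
qed

lemma finite_parabolic_of_central:
  assumes z: "z \<in> group_center W" and T: "T \<subseteq> S" "T \<subseteq> inversions z"
  shows "finite (generate W T)"
proof -
  have "inversions x \<subseteq> inversions z" if x: "x \<in> generate W T" for x
  proof
    fix r assume "r \<in> inversions x"
    then obtain v j where "v \<in> generate W T" "j \<in> T" "r \<in> carrier W" "conj_by v r = j"
      using mem_inversions_generate[OF T(1) x] by blast
    then show "r \<in> inversions z" using inversions_central_conj[OF z, of v r] T generate_closed[OF T(1), of v] by auto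
  qed
  then have "inversions ` generate W T \<subseteq> Pow (inversions z)" by blast
  moreover have "finite (Pow (inversions z))"
    using z finite_inversions by (simp add: group_center_def)
  moreover have "inj_on inversions (generate W T)"
    using inversions_inj generate_closed[OF T(1)] by (meson inj_on_subset subsetI)
  ultimately show ?thesis using finite_imageD finite_subset by blast
qed

section \<open>The irreducible decomposition\<close>

definition commuting :: "'a set \<Rightarrow> 'a set \<Rightarrow> bool" where
  "commuting A B \<longleftrightarrow> (\<forall>a\<in>A. \<forall>b\<in>B. a \<otimes> b = b \<otimes> a)"

lemma commutingD: "commuting A B \<Longrightarrow> a \<in> A \<Longrightarrow> b \<in> B \<Longrightarrow> a \<otimes> b = b \<otimes> a"
  unfolding commuting_def by blast

lemma commuting_sym: "commuting A B \<longleftrightarrow> commuting B A"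
  by (auto simp: commuting_def)

lemma commuting_mono: "commuting A B \<Longrightarrow> A' \<subseteq> A \<Longrightarrow> B' \<subseteq> B \<Longrightarrow> commuting A' B'"
  by (auto simp: commuting_def)

lemma commuting_generate:
  assumes "A \<subseteq> carrier W" "B \<subseteq> carrier W" "commuting A B"
  shows "commuting A (generate W B)"
proof -
  have "a \<otimes> y = y \<otimes> a" if a: "a \<in> A" and y: "y \<in> generate W B" for a y
    using y
  proof induction
    case one
    then show ?case using a assms by auto
  next
    case (incl h)
    then show ?case using a assms by (auto simp: commuting_def)
  next
    case (inv h)
    then have c: "a \<in> carrier W" "h \<in> carrier W" "h \<otimes> a = a \<otimes> h"
      using a assms by (auto simp: commuting_def)
    then have "conj_by h a = a" by (simp add: conj_by_eq_iff)
    then have "conj_by (inv h) a = a" using c conj_by_mult[of "inv h" h a] by simp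
    then show ?case using c conj_by_eq_iff[of "inv h" a a] by simp
  next
    case (eng g h)
    then have "g \<in> carrier W" "h \<in> carrier W" using generate_in_carrier assms by auto
    then show ?case using eng a assms by (metis m_assoc subsetD)
  qed
  then show ?thesis unfolding commuting_def by blast
qed

lemma generate_UN_generate:
  assumes "\<Union>Q \<subseteq> S"
  shows "generate W (\<Union>A\<in>Q. generate W A) = generate W (\<Union>Q)"
proof
  have "subgroup (generate W (\<Union>Q)) W"
    using assms S_carrier by (intro generate_is_subgroup) blast
  moreover have "(\<Union>A\<in>Q. generate W A) \<subseteq> generate W (\<Union>Q)"
    using mono_generate by (meson UN_least Union_upper)
  ultimately show "generate W (\<Union>A\<in>Q. generate W A) \<subseteq> generate W (\<Union>Q)"
    using generate_subgroup_incl by blast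
  show "generate W (\<Union>Q) \<subseteq> generate W (\<Union>A\<in>Q. generate W A)"
  proof (intro mono_generate Union_least subsetI)
    fix A x assume "A \<in> Q" "x \<in> A"
    then show "x \<in> (\<Union>A\<in>Q. generate W A)" using generate.incl[of x A W] by blast
  qed
qed

section \<open>Direct products of parabolic subgroups as commutation of generators\<close>

lemma carrier_parabolic: "T \<subseteq> S \<Longrightarrow> carrier (subgroup_generated W T) = generate W T"
  using S_carrier by (simp add: carrier_subgroup_generated Int_absorb1)

lemma generate_parabolic:
  assumes "T \<subseteq> S" "A \<subseteq> generate W T"
  shows "generate (subgroup_generated W T) A = generate W A"
proof -
  have "subgroup (generate W T) W" using assms S_carrier by (intro generate_is_subgroup) blast
  moreover have "subgroup_generated W T = W\<lparr>carrier := generate W T\<rparr>"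
    using assms(1) S_carrier by (simp add: subgroup_generated_def Int_absorb1)
  ultimately show ?thesis using generate_consistent assms(2) by simp
qed

lemma internal_direct_product_cong:
  assumes "\<And>i. i \<in> I \<Longrightarrow> H i = H' i"
  shows "internal_direct_product G I H = internal_direct_product G I H'"
  using assms by (simp add: internal_direct_product_def)

lemma normal_parabolic:
  assumes T: "T \<subseteq> S" and A: "A \<subseteq> T" "commuting A (T - A)"
  shows "generate W A \<lhd> subgroup_generated W T"
proof -
  interpret P: group "subgroup_generated W T" by simp
  have AS: "A \<subseteq> S" using A T by blast
  have AT: "generate W A \<subseteq> generate W T" using A by (intro mono_generate)
  have comm: "commuting (generate W A) (T - A)"
    using commuting_generate[of "T - A" A] A AS T S_carrier commuting_sym by blast
  \<comment> \<open>Conjugation need only be checked for letters: those in \<open>A\<close> lie in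
    the subgroup, the others commute with it.\<close>
  have letter: "conj_by t h \<in> generate W A" if t: "t \<in> T" and h: "h \<in> generate W A" for t h
  proof (cases "t \<in> A")
    case True
    then have "t \<in> generate W A" by (rule generate.incl)
    then show ?thesis using generate_conj_closed[OF AS] h generate_closed[OF AS h] by blast
  next
    case False
    then have "h \<otimes> t = t \<otimes> h" using commutingD[OF comm h] t by simp
    moreover have "t \<in> carrier W" using t T S_carrier by blast
    ultimately have "conj_by t h = h"
      using conj_by_eq_iff[of t h h] generate_closed[OF AS h] by simp
    then show ?thesis using h by simp
  qed
  have conj: "\<forall>h\<in>generate W A. conj_by x h \<in> generate W A" if "x \<in> generate W T" for x
    using that
  proof induction
    case one
    then show ?case using generate_closed[OF AS] by simp
  next
    case (inv t)
    then have "inv t = t" using T by auto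
    then show ?case using letter inv by simp
  next
    case (eng g h)
    then show ?case
      using generate_closed[OF T] generate_closed[OF AS] by (simp add: conj_by_mult)
  qed (use letter in blast)
  show ?thesis
    unfolding P.normal_inv_iff
  proof (intro conjI ballI)
    have "subgroup (generate W A) W" using AS S_carrier by (intro generate_is_subgroup) blast
    then show "subgroup (generate W A) (subgroup_generated W T)"
      using AT T by (simp add: subgroup_subgroup_generated_iff carrier_parabolic)
  qed (use conj T in \<open>auto simp: conj_by_def carrier_parabolic inv_subgroup_generated\<close>)
qed

text \<open>Generation and trivial intersections are automatic for disjoint generating sets, so only
  normality is at stake. Normal subgroups meeting trivially commute; conversely
  \<open>normal_parabolic\<close> applies.\<close>

lemma internal_direct_product_parabolic_iff:
  assumes T: "T \<subseteq> S" and P: "disjoint P" "\<Union>P = T"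
  shows "internal_direct_product (subgroup_generated W T) P (generate (subgroup_generated W T))
    \<longleftrightarrow> (\<forall>A\<in>P. \<forall>B\<in>P. A \<noteq> B \<longrightarrow> commuting A B)"
proof -
  interpret G: group "subgroup_generated W T" by simp
  let ?G = "subgroup_generated W T"
  have sub: "A \<subseteq> generate W T" if "A \<subseteq> T" for A
    using that by (auto intro: generate.incl)
  have gen: "generate W A \<subseteq> generate W T" if "A \<subseteq> T" for A using that by (rule mono_generate)
  have gen_UN: "generate ?G (\<Union>A\<in>Q. generate W A) = generate W (\<Union>Q)" if "Q \<subseteq> P" for Q
  proof -
    have "(\<Union>A\<in>Q. generate W A) \<subseteq> generate W T" using that P gen by blast
    moreover have "\<Union>Q \<subseteq> S" using that P T by blast
    ultimately show ?thesis using generate_parabolic[OF T] generate_UN_generate by simp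
  qed
  have "generate ?G A = generate W A" if "A \<in> P" for A
    using that P sub generate_parabolic[OF T] by blast
  then have idp: "internal_direct_product ?G P (generate ?G) = internal_direct_product ?G P (generate W)"
    by (rule internal_direct_product_cong)
  have disj: "generate W A \<inter> generate W (\<Union>(P - {A})) = {\<one>}" if "A \<in> P" for A
    using that P T by (intro generate_disjoint) (auto simp: disjoint_def)
  have AB: "generate W A \<inter> generate W B \<subseteq> {\<one>}" if "A \<in> P" "B \<in> P" "A \<noteq> B" for A B
    using that P T generate_disjoint[of A B] by (auto simp: disjoint_def)
  show ?thesis
  proof
    assume "internal_direct_product ?G P (generate ?G)"
    then have normal: "generate W A \<lhd> ?G" if "A \<in> P" for A
      using that unfolding idp by (simp add: internal_direct_product_def)
    show "\<forall>A\<in>P. \<forall>B\<in>P. A \<noteq> B \<longrightarrow> commuting A B"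
    proof (intro ballI impI)
      fix A B assume *: "A \<in> P" "B \<in> P" "A \<noteq> B"
      show "commuting A B"
        using G.normal_imp_commuting[OF normal[OF *(1)] normal[OF *(2)]] AB[OF *]
        by (auto simp: commuting_def intro: generate.incl)
    qed
  next
    assume comm: "\<forall>A\<in>P. \<forall>B\<in>P. A \<noteq> B \<longrightarrow> commuting A B"
    have "generate W A \<lhd> ?G" if "A \<in> P" for A
      using that P comm by (intro normal_parabolic[OF T]) (auto simp: commuting_def)
    then have "internal_direct_product ?G P (generate W)"
      unfolding internal_direct_product_def
      using gen_UN[OF subset_refl] gen_UN[OF Diff_subset] disj P T by (simp add: carrier_parabolic)
    then show "internal_direct_product ?G P (generate ?G)" using idp by simp
  qed
qed

lemma coxeter_irreducible_parabolic_iff: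
  assumes "T \<subseteq> S"
  shows "coxeter_irreducible (subgroup_generated W T) T
    \<longleftrightarrow> (\<forall>A. A \<noteq> {} \<and> A \<subset> T \<longrightarrow> \<not> commuting A (T - A))"
proof -
  have "internal_direct_product (subgroup_generated W T) {A, T - A} (generate (subgroup_generated W T))
      \<longleftrightarrow> commuting A (T - A)" if "A \<noteq> {}" "A \<subset> T" for A
  proof -
    have "disjoint {A, T - A}" "\<Union>{A, T - A} = T" using that by (auto simp: disjoint_def)
    from internal_direct_product_parabolic_iff[OF assms this] show ?thesis
      using that commuting_sym[of A "T - A"] by auto
  qed
  then show ?thesis by (auto simp: coxeter_irreducible_def)
qed

text \<open>Turns the group-theoretic notion into a condition on which generators commute; existence
  and uniqueness are then combinatorial.\<close>

lemma irreducible_decomposition_iff: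
  "irreducible_decomposition W S P \<longleftrightarrow>
    partition_on S P \<and> (\<forall>A\<in>P. \<forall>B\<in>P. A \<noteq> B \<longrightarrow> commuting A B) \<and>
    (\<forall>T\<in>P. \<forall>A. A \<noteq> {} \<and> A \<subset> T \<longrightarrow> \<not> commuting A (T - A))"
proof (cases "partition_on S P")
  case True
  then have P: "disjoint P" "\<Union>P = S" "\<And>T. T \<in> P \<Longrightarrow> T \<subseteq> S" by (auto simp: partition_on_def)
  have "subgroup_generated W S = W"
    using generate_S S_carrier by (simp add: subgroup_generated_def Int_absorb1)
  with internal_direct_product_parabolic_iff[OF subset_refl P(1,2)] show ?thesis
    using True P(3) by (simp add: irreducible_decomposition_def coxeter_irreducible_parabolic_iff)
qed (simp add: irreducible_decomposition_def)

section \<open>Components of the Coxeter graph\<close>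

definition isolated :: "'a set \<Rightarrow> bool" where
  "isolated A \<longleftrightarrow> A \<subseteq> S \<and> commuting A (S - A)"

text \<open>The classes are the connected components of the Coxeter graph: the isolated sets form a
  Boolean algebra whose atoms are the components.\<close>

definition component_rel :: "('a \<times> 'a) set" where
  "component_rel = {(s, t) \<in> S \<times> S. \<forall>A. isolated A \<longrightarrow> (s \<in> A \<longleftrightarrow> t \<in> A)}"

lemma equiv_component_rel: "equiv S component_rel"
  by (auto simp: equiv_def component_rel_def refl_on_def sym_def trans_def)

text \<open>An element outside a class is separated from all of the class by one isolated set, and
  elements on opposite sides of an isolated set commute.\<close>

lemma component_isolated:
  assumes "C \<in> S // component_rel"
  shows "isolated C"
proof -
  obtain s where s: "s \<in> S" "C = component_rel `` {s}" using assms by (rule quotientE)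
  have "a \<otimes> b = b \<otimes> a" if "a \<in> C" "b \<in> S - C" for a b
  proof -
    have "b \<in> S" "(s, b) \<notin> component_rel" using that s by auto
    then obtain A where A: "isolated A" "(s \<in> A) \<noteq> (b \<in> A)"
      using s(1) unfolding component_rel_def by blast
    then have "(s \<in> A) = (a \<in> A)" "a \<in> S" using that s by (auto simp: component_rel_def)
    moreover have "commuting A (S - A)" using A(1) by (simp add: isolated_def)
    ultimately show ?thesis
      using commutingD[of A "S - A" a b] commutingD[of A "S - A" b a] A(2) \<open>b \<in> S\<close> by auto
  qed
  then show ?thesis using s by (auto simp: isolated_def commuting_def component_rel_def)
qed

lemma irreducible_decomposition_components:
  "irreducible_decomposition W S (S // component_rel)"
  unfolding irreducible_decomposition_iff
proof (intro conjI ballI allI impI notI)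
  show part: "partition_on S (S // component_rel)"
    using equiv_component_rel by (rule partition_on_quotient)
  show "commuting A B"
    if "A \<in> S // component_rel" "B \<in> S // component_rel" "A \<noteq> B" for A B
  proof -
    have "A \<inter> B = {}" using part that by (auto simp: partition_on_def disjoint_def)
    moreover have "B \<subseteq> S" using component_isolated[OF that(2)] by (simp add: isolated_def)
    ultimately have "B \<subseteq> S - A" by blast
    moreover have "commuting A (S - A)" using component_isolated[OF that(1)] by (simp add: isolated_def)
    ultimately show ?thesis using commuting_mono by blast
  qed
  fix C A
  assume C: "C \<in> S // component_rel" and A: "A \<noteq> {} \<and> A \<subset> C" "commuting A (C - A)"
  \<comment> \<open>\<open>A\<close> commutes with the rest of \<open>C\<close> by assumption and
    with everything outside \<open>C\<close> because \<open>C\<close> is isolated. So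
    \<open>A\<close> would separate equivalent generators.\<close>
  have "isolated A"
    using component_isolated[OF C] A unfolding isolated_def commuting_def by blast
  moreover obtain a b where "a \<in> A" "b \<in> C" "b \<notin> A" "a \<in> C" using A by blast
  moreover have "(a, b) \<in> component_rel"
    using quotient_eq_iff[OF equiv_component_rel C C] calculation by blast
  ultimately show False by (auto simp: component_rel_def)
qed

lemma irreducible_decomposition_unique:
  assumes "irreducible_decomposition W S P"
  shows "P = S // component_rel"
proof -
  have P: "disjoint P" "\<Union>P = S" "{} \<notin> P"
    and comm: "\<And>A B. A \<in> P \<Longrightarrow> B \<in> P \<Longrightarrow> A \<noteq> B \<Longrightarrow> commuting A B"
    and irr: "\<And>T A. T \<in> P \<Longrightarrow> A \<noteq> {} \<Longrightarrow> A \<subset> T \<Longrightarrow> \<not> commuting A (T - A)"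
    using assms by (auto simp: irreducible_decomposition_iff partition_on_def)
  \<comment> \<open>A block is isolated, so it contains the class of each of its elements;
    irreducibility keeps isolated sets from splitting it, so it lies in one class.\<close>
  have block_eq: "T = component_rel `` {s}" if T: "T \<in> P" "s \<in> T" for T s
  proof
    have "isolated T"
      unfolding isolated_def commuting_def
    proof (intro conjI ballI)
      show "T \<subseteq> S" using T P by blast
      fix a b assume "a \<in> T" "b \<in> S - T"
      then obtain B where "B \<in> P" "b \<in> B" "B \<noteq> T" using P by blast
      then show "a \<otimes> b = b \<otimes> a" using comm[of T B] T \<open>a \<in> T\<close> by (auto simp: commuting_def)
    qed
    then show "component_rel `` {s} \<subseteq> T" using T by (auto simp: component_rel_def)
    have "s \<in> A \<longleftrightarrow> t \<in> A" if "t \<in> T" "isolated A" for t A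
    proof (rule ccontr)
      assume "(s \<in> A) \<noteq> (t \<in> A)"
      then have "A \<inter> T \<noteq> {}" "A \<inter> T \<subset> T" using T that by auto
      moreover have "commuting (A \<inter> T) (T - A \<inter> T)"
        using that T P by (auto simp: isolated_def commuting_def)
      ultimately show False using irr[OF T(1), of "A \<inter> T"] by simp
    qed
    moreover have "T \<subseteq> S" using T(1) P(2) by blast
    ultimately show "T \<subseteq> component_rel `` {s}" using T(2) unfolding component_rel_def by blast
  qed
  show ?thesis
  proof
    show "P \<subseteq> S // component_rel"
    proof
      fix T assume "T \<in> P"
      then have "T \<noteq> {}" using P(3) by metis
      then obtain s where s: "s \<in> T" by blast
      then have "s \<in> S" using \<open>T \<in> P\<close> P(2) by blast
      then show "T \<in> S // component_rel"
        unfolding block_eq[OF \<open>T \<in> P\<close> s] by (rule quotientI)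
    qed
    show "S // component_rel \<subseteq> P"
    proof
      fix C assume "C \<in> S // component_rel"
      then obtain s where "s \<in> S" "C = component_rel `` {s}" by (rule quotientE)
      moreover from this(1) obtain T where "T \<in> P" "s \<in> T" using P(2) by blast
      ultimately show "C \<in> P" using block_eq by simp
    qed
  qed
qed

lemma irreducible_components_eq: "irreducible_components W S = S // component_rel"
  unfolding irreducible_components_def
  using irreducible_decomposition_components irreducible_decomposition_unique
  by (rule the_equality)

lemma essential_generators_eq:
  "essential_generators W S = \<Union>{T \<in> S // component_rel. infinite (generate W T)}"
proof -
  have "carrier (subgroup_generated W T) = generate W T" if "T \<in> S // component_rel" for T
    using component_isolated[OF that] by (simp add: isolated_def carrier_parabolic)
  then show ?thesis unfolding essential_generators_def irreducible_components_eq by auto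
qed

lemma isolated_essential: "isolated (essential_generators W S)"
proof -
  have union: "isolated (\<Union>Q)" if "Q \<subseteq> S // component_rel" for Q
    unfolding isolated_def
  proof
    show "\<Union>Q \<subseteq> S" using that component_isolated unfolding isolated_def by blast
    show "commuting (\<Union>Q) (S - \<Union>Q)"
      unfolding commuting_def
    proof (intro ballI)
      fix a b assume "a \<in> \<Union>Q" "b \<in> S - \<Union>Q"
      then obtain T where "T \<in> Q" "a \<in> T" "b \<in> S - T" by blast
      then show "a \<otimes> b = b \<otimes> a"
        using component_isolated[of T] that commutingD[of T "S - T"] unfolding isolated_def by blast
    qed
  qed
  show ?thesis unfolding essential_generators_eq by (rule union) (rule Collect_restrict)
qed

lemma isolated_compl: "isolated A \<Longrightarrow> isolated (S - A)"
  by (auto simp: isolated_def commuting_def)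

section \<open>The center\<close>

lemma central_inversions_essential:
  assumes z: "z \<in> group_center W"
  shows "inversions z \<inter> essential_generators W S = {}"
proof -
  have iso: "isolated (inversions z \<inter> S)"
    using central_descents_commute[OF z] by (auto simp: isolated_def commuting_def)
  have "finite (generate W T)" if T: "T \<in> S // component_rel" and s: "s \<in> T" "s \<in> inversions z" for T s
  proof -
    have "T \<subseteq> S" using component_isolated[OF T] by (simp add: isolated_def)
    moreover have "(s, t) \<in> component_rel" if "t \<in> T" for t
      using quotient_eq_iff[OF equiv_component_rel T T s(1) that] by simp
    \<comment> \<open>The isolated set of descents of \<open>z\<close> contains \<open>s\<close>,
      hence the whole class of \<open>s\<close>.\<close>
    then have "T \<subseteq> inversions z" using iso s \<open>T \<subseteq> S\<close> by (fastforce simp: component_rel_def)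
    ultimately show ?thesis using finite_parabolic_of_central[OF z] by simp
  qed
  then show ?thesis unfolding essential_generators_eq by blast
qed

lemma central_essential_trivial:
  "group_center W \<inter> generate W (essential_generators W S) = {\<one>}"
proof -
  have "essential_generators W S \<subseteq> S" using isolated_essential by (simp add: isolated_def)
  then have "z = \<one>" if "z \<in> group_center W" "z \<in> generate W (essential_generators W S)" for z
    using central_inversions_essential[OF that(1)] ex_descent[OF _ that(2)] by blast
  moreover have "\<one> \<in> group_center W" by (simp add: group_center_def)
  ultimately show ?thesis using generate.one[of W] by blast
qed

lemma central_iff: "z \<in> group_center W \<longleftrightarrow> z \<in> carrier W \<and> commuting {z} S"
  using commuting_generate[of "{z}" S] S_carrier
  by (auto simp: group_center_def commuting_def generate_S)

text \<open>Generators outside \<open>A\<close> commute with the subgroup of \<open>A\<close>, so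
  being central there already means being central in \<open>W\<close>.\<close>

lemma center_isolated:
  assumes "isolated A"
  shows "group_center (subgroup_generated W A) = group_center W \<inter> generate W A"
proof -
  have A: "A \<subseteq> S" "A \<subseteq> carrier W" "S - A \<subseteq> carrier W" and comm: "commuting (S - A) A"
    using assms S_carrier by (auto simp: isolated_def commuting_def)
  have "z \<in> group_center (subgroup_generated W A) \<longleftrightarrow> z \<in> group_center W"
    if z: "z \<in> generate W A" for z
  proof -
    have "z \<otimes> b = b \<otimes> z" if "b \<in> S - A" for b
      using commutingD[OF commuting_generate[OF A(3,2) comm] that z] by simp
    then have "commuting {z} S \<longleftrightarrow> commuting {z} A" using A(1) by (auto simp: commuting_def)
    moreover have "commuting {z} A \<longleftrightarrow> commuting {z} (generate W A)"
      using commuting_generate[of "{z}" A] A z generate_closed[OF A(1)] generate.incl[of _ A W]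
      by (auto simp: commuting_def)
    ultimately show ?thesis
      using z generate_closed[OF A(1)] unfolding central_iff
      by (simp add: group_center_def carrier_parabolic[OF A(1)] commuting_def)
  qed
  moreover have "group_center (subgroup_generated W A) \<subseteq> generate W A"
    using carrier_parabolic[OF A(1)] by (auto simp: group_center_def)
  ultimately show ?thesis by blast
qed

text \<open>Letters outside \<open>A\<close> can be moved to the right past the factor from
  \<open>A\<close>.\<close>

lemma isolated_factorization:
  assumes A: "isolated A" and z: "z \<in> carrier W"
  shows "\<exists>a \<in> generate W A. \<exists>b \<in> generate W (S - A). z = a \<otimes> b"
proof -
  have AS: "A \<subseteq> S" "S - A \<subseteq> S" using A by (auto simp: isolated_def)
  have comm: "commuting (S - A) (generate W A)"
    using A S_carrier by (intro commuting_generate) (auto simp: isolated_def commuting_def)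
  obtain w where w: "set w \<subseteq> S" "z = val w" using carrier_valE[OF z] .
  have "\<exists>a \<in> generate W A. \<exists>b \<in> generate W (S - A). val w = a \<otimes> b"
    using w(1)
  proof (induction w)
    case Nil
    then show ?case using generate.one by (auto intro!: bexI[of _ \<one>])
  next
    case (Cons s w)
    then obtain a b where ab: "a \<in> generate W A" "b \<in> generate W (S - A)" "val w = a \<otimes> b" by auto
    have c: "a \<in> carrier W" "b \<in> carrier W" "s \<in> carrier W"
      using generate_closed[OF AS(1) ab(1)] generate_closed[OF AS(2) ab(2)] Cons by auto
    show ?case
    proof (cases "s \<in> A")
      case True
      then have "s \<otimes> a \<in> generate W A" using ab generate.incl[of s A W] by (simp add: generate.eng)
      moreover have "val (s # w) = (s \<otimes> a) \<otimes> b" using ab c by (simp add: m_assoc)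
      ultimately show ?thesis using ab by blast
    next
      case False
      then have s: "s \<in> S - A" using Cons by auto
      then have "s \<otimes> b \<in> generate W (S - A)"
        using ab generate.incl[of s "S - A" W] by (simp add: generate.eng)
      moreover have "s \<otimes> a = a \<otimes> s" using comm s ab by (simp add: commuting_def)
      then have "val (s # w) = a \<otimes> (s \<otimes> b)" using ab c by (simp flip: m_assoc)
      ultimately show ?thesis using ab by blast
    qed
  qed
  then show ?thesis using w by simp
qed

lemma center_subset_nonessential:
  "group_center W \<subseteq> generate W (S - essential_generators W S)"
proof
  let ?E = "essential_generators W S"
  fix z assume z: "z \<in> group_center W"
  then have zc: "z \<in> carrier W" by (simp add: group_center_def)
  obtain a b where ab: "a \<in> generate W ?E" "b \<in> generate W (S - ?E)" "z = a \<otimes> b"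
    using isolated_factorization[OF isolated_essential zc] by blast
  have E: "?E \<subseteq> S" "S - ?E \<subseteq> S" using isolated_essential by (auto simp: isolated_def)
  have c: "a \<in> carrier W" "b \<in> carrier W"
    using generate_closed[OF E(1) ab(1)] generate_closed[OF E(2) ab(2)] by auto
  have comm: "commuting (S - ?E) (generate W ?E)" "commuting ?E (generate W (S - ?E))"
  proof -
    have "commuting ?E (S - ?E)" using isolated_essential by (simp add: isolated_def)
    moreover have "?E \<subseteq> carrier W" "S - ?E \<subseteq> carrier W" using E S_carrier by auto
    ultimately show "commuting (S - ?E) (generate W ?E)" "commuting ?E (generate W (S - ?E))"
      using commuting_generate commuting_sym by blast+
  qed
  \<comment> \<open>The essential factor \<open>a\<close> is itself central: for essential
    \<open>s\<close> both \<open>z\<close> and \<open>b\<close> commute with \<open>s\<close>, and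
    the other generators commute with the whole essential subgroup.\<close>
  have "a \<otimes> s = s \<otimes> a" if s: "s \<in> S" for s
  proof (cases "s \<in> ?E")
    case True
    then have "s \<otimes> b = b \<otimes> s" using comm ab by (simp add: commuting_def)
    moreover have "z \<otimes> s = s \<otimes> z" using z s by (simp add: group_center_def)
    ultimately have "(a \<otimes> s) \<otimes> b = (s \<otimes> a) \<otimes> b" using ab c s by (simp add: m_assoc)
    then show ?thesis using c s by simp
  next
    case False
    then show ?thesis using comm ab s by (simp add: commuting_def)
  qed
  then have "a \<in> group_center W" using c by (simp add: central_iff commuting_def)
  then have "a = \<one>" using central_essential_trivial ab by blast
  then show "z \<in> generate W (S - ?E)" using ab c by simp
qed

lemma center_essential:
  "group_center W = group_center (subgroup_generated W (S - essential_generators W S)) \<and>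
    group_center (subgroup_generated W (essential_generators W S)) = {\<one>}"
  using center_isolated[OF isolated_essential] center_isolated[OF isolated_compl[OF isolated_essential]]
    center_subset_nonessential central_essential_trivial by blast

end

theorem theorem1p2:
  fixes W :: "('a, 'b) monoid_scheme" and S :: "'a set"
  assumes "coxeter_system W S"
  shows "group_center W
           = group_center (subgroup_generated W (S - essential_generators W S)) \<and>
         group_center (subgroup_generated W (essential_generators W S)) = {\<one>\<^bsub>W\<^esub>}"
proof -
  obtain m where m: "coxeter_matrix S m" "has_presentation W S (coxeter_relators S m)"
    using assms by (auto simp: coxeter_system_def)
  then interpret coxeter W S m
    by (intro coxeter.intro) (auto simp: coxeter_axioms_def has_presentation_def)
  show ?thesis by (rule center_essential)
qed

end
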